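(* For $x\in\mathbb{N}^2$ let $M_n(x)$ be the number of lattice walks of length $n$ with steps in $\{(1,-1),(1,1),(-1,1)\}$ which start at $x$, are confined to the positive quadrant $\mathbb{N}^2$, and end on the line $\{(k,1):k\ge1\}$. Then for every starting point $x\in\mathbb{N}^2$ there exists a constant $C(x)$ such that $M_n(x)$ is asymptotically equivalent to $$C(x)\,\frac{2^{3n/2}}{n^{3/2}}$$ as $n\to\infty$.
   Context: $\mathbb{N}=\{1,2,\dots\}$. A walk of length $n$ is a sequence of $n$ steps from the given step set; it is confined to the positive quadrant if all its vertices lie in $\mathbb{N}^2$.
   Formalization: Each step changes the parity of the second coordinate, so M_n(x)=0 whenever n+x_2 is even and the equivalence fails along all n; it is proved, with C(x)>0, for n→∞ through n with n+x_2 odd, together with M_n(x)=0 for all other n. *)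

theory Defs
  imports Complex_Main "HOL-Library.Product_Plus" "HOL-Library.Landau_Symbols"
begin

definition steps :: "(int \<times> int) set" where
  "steps = {(1, -1), (1, 1), (-1, 1)}"

text \<open>The natural numbers of the model start at 1.\<close>

definition quadrant :: "(int \<times> int) set" where
  "quadrant = {(i, j). 1 \<le> i \<and> 1 \<le> j}"

definition axis :: "(int \<times> int) set" where
  "axis = {(k, 1) | k. 1 \<le> k}"

text \<open>A walk is the list of its steps; its vertex after \<open>k\<close> steps is
  \<^term>\<open>x + sum_list (take k w)\<close>, so that \<open>k = 0\<close> gives the starting point.\<close>

definition walks :: "nat \<Rightarrow> int \<times> int \<Rightarrow> (int \<times> int) list set" where
  "walks n x = {w. length w = n \<and> set w \<subseteq> steps \<and>
     (\<forall>k\<le>n. x + sum_list (take k w) \<in> quadrant) \<and> x + sum_list w \<in> axis}"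

definition M :: "nat \<Rightarrow> int \<times> int \<Rightarrow> nat" where
  "M n x = card (walks n x)"

text \<open>Every step changes the parity of the second coordinate, so a walk of length \<open>n\<close>
  from \<open>x\<close> can end at height 1 only if \<open>n + snd x\<close> is odd. The asymptotics
  of \<^term>\<open>\<lambda>n. M n x\<close> are therefore taken along these \<open>n\<close>.\<close>

definition admissible :: "int \<times> int \<Rightarrow> nat set" where
  "admissible x = {n. odd (int n + snd x)}"

end

theory Submission
  imports "HOL-Analysis.Gamma_Function" "HOL-Real_Asymp.Real_Asymp" Defs
begin

text \<open>
  Forget the first coordinate. A walk counted by \<^term>\<open>M n (i, int h + 1)\<close> projects to a path
  with steps \<open>\<plusminus>1\<close> from height \<open>h + 1\<close> to height 1 that stays positive; if it goes up \<open>u\<close> times, then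
  \<open>n = 2 * u + h\<close>. These paths are counted by the ballot number \<open>ballot h u\<close>. Each step up can be
  lifted in two ways, to the right or to the left, and each step down in one way, to the right.
  So the number of walks is \<open>2 ^ u * ballot h u * surv i h u\<close>, where \<open>surv i h u\<close> is the probability
  that a uniformly random ballot path, lifted with independent fair coins, never leaves the half
  plane \<open>i \<ge> 1\<close> (lemma \<open>M_eq\<close>). The ballot number has order \<open>4 ^ u / u powr (3 / 2)\<close>
  (\<open>ballot_limit\<close>), so everything reduces to showing that \<open>surv i h u\<close> has a positive limit as \<open>u\<close>
  grows. Two observations give this without any analysis of the limiting process.

  \<^item> The probability decreases in \<open>u\<close> (\<open>surv_antimono\<close>). A longer ballot path is stochastically
    higher, so by any given time it has gone up more often; with the same coins its first coordinate
    is then never further to the right.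

  \<^item> It is bounded away from 0 (\<open>surv_lower_bound\<close>). The first coordinate drifts to the right, since
    steps down always move right and steps up are balanced, and steps down have probability at least
    1/4 except at height 1. Hence \<open>(3 / 4) ^ i\<close>, corrected by a factor at height 1, is a
    supermartingale, and its initial value bounds the probability of leaving.
\<close>

section \<open>Recurrences for the walk numbers\<close>

lemma finite_walks: "finite (walks n x)"
proof (rule finite_subset)
  show "walks n x \<subseteq> {w. set w \<subseteq> steps \<and> length w = n}"
    by (auto simp: walks_def)
  show "finite {w. set w \<subseteq> steps \<and> length w = n}"
    by (intro finite_lists_length_eq) (simp add: steps_def)
qed

lemma walks_outside: "x \<notin> quadrant \<Longrightarrow> walks n x = {}"
  by (auto simp: walks_def intro!: exI[of _ 0])

lemma M_outside: "x \<notin> quadrant \<Longrightarrow> M n x = 0"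
  by (simp add: M_def walks_outside)

lemma M_0: "M 0 x = (if x \<in> axis then 1 else 0)"
proof -
  have "walks 0 x = (if x \<in> axis then {[]} else {})"
    by (auto simp: walks_def axis_def quadrant_def)
  then show ?thesis by (simp add: M_def)
qed

lemma walks_Suc:
  assumes "x \<in> quadrant"
  shows "walks (Suc n) x = (\<Union>s\<in>steps. (#) s ` walks n (x + s))"
proof -
  have all_le_Suc: "(\<forall>k\<le>Suc n. P k) \<longleftrightarrow> P 0 \<and> (\<forall>k\<le>n. P (Suc k))" for P
    by (metis Suc_le_mono not0_implies_Suc zero_le)
  have "w \<in> walks (Suc n) x \<longleftrightarrow> w \<in> (\<Union>s\<in>steps. (#) s ` walks n (x + s))" for w
  proof (cases w)
    case (Cons s v)
    then show ?thesis using assms by (auto simp: walks_def all_le_Suc add.assoc)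
  qed (auto simp: walks_def)
  then show ?thesis by blast
qed

lemma M_Suc:
  assumes "x \<in> quadrant"
  shows "M (Suc n) x = M n (x + (1, -1)) + M n (x + (1, 1)) + M n (x + (-1, 1))"
proof -
  have "M (Suc n) x = (\<Sum>s\<in>steps. card ((#) s ` walks n (x + s)))"
    unfolding M_def walks_Suc[OF assms]
    by (rule card_UN_disjoint) (auto simp: steps_def finite_walks)
  also have "\<dots> = (\<Sum>s\<in>steps. M n (x + s))"
    by (simp add: M_def card_image)
  finally show ?thesis by (simp add: steps_def)
qed

lemma M_parity: "n \<notin> admissible x \<Longrightarrow> M n x = 0"
proof (induction n arbitrary: x)
  case 0
  then show ?case by (auto simp: M_0 axis_def admissible_def)
next
  case (Suc n)
  then have "M n (x + s) = 0" if "s \<in> steps" for s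
    using that by (intro Suc.IH) (auto simp: admissible_def steps_def)
  then show ?case
    by (cases "x \<in> quadrant") (simp_all add: M_Suc M_outside steps_def)
qed

lemma M_too_high: "int n + 1 < j \<Longrightarrow> M n (i, j) = 0"
proof (induction n arbitrary: i j)
  case 0
  then show ?case by (auto simp: M_0 axis_def)
next
  case (Suc n)
  then show ?case
    by (cases "(i, j) \<in> quadrant") (simp_all add: M_Suc M_outside)
qed

section \<open>The survival probability\<close>

text \<open>The probability that a uniformly random ballot path starts with a step down, from height
  \<open>h + 1\<close> to height 1 with \<open>u\<close> steps up still to be made. It is a quotient of two ballot numbers
  (\<open>ballot_down\<close>, \<open>ballot_up\<close>).\<close>
definition down :: "nat \<Rightarrow> nat \<Rightarrow> real" where
  "down h u = real h * real (u + h + 1) / (real (h + 1) * real (2 * u + h))"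

lemma down_0 [simp]: "down 0 u = 0"
  by (simp add: down_def)

lemma one_minus_down:
  "1 - down h (Suc u) = real (h + 2) * real (u + 1) / (real (h + 1) * real (2 * u + h + 2))"
  by (simp add: down_def divide_simps) (simp add: algebra_simps)

lemma down_nonneg: "0 \<le> down h u"
  by (simp add: down_def)

lemma down_le_1: "down h (Suc u) \<le> 1"
proof -
  have "0 \<le> 1 - down h (Suc u)" unfolding one_minus_down by simp
  then show ?thesis by simp
qed

text \<open>The more time is left, the weaker the pull towards height 1.\<close>
lemma down_antimono: "down h (Suc (Suc u)) \<le> down h (Suc u)"
proof -
  have d: "down h (Suc v) = real h / (real h + 1) * ((real v + real h + 2) / (2 * real v + real h + 2))"
    for v by (simp add: down_def divide_simps) (simp add: algebra_simps)
  show ?thesis unfolding d by (intro mult_left_mono) (simp_all add: field_simps)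
qed

lemma down_ge_quarter: "1 / 4 \<le> down (Suc h) (Suc u)"
  by (simp add: down_def divide_simps) (simp add: algebra_simps)

text \<open>The recursion conditions on the first step of the random lifted path from \<open>(i, h + 1)\<close>.
  For \<open>u = 0\<close> the path consists of steps to the lower right, which cannot leave the half plane.
  Counting by \<open>h\<close> and \<open>u\<close> instead of the length makes parity disappear and keeps all weights in
  the unit interval.\<close>
fun surv :: "int \<Rightarrow> nat \<Rightarrow> nat \<Rightarrow> real" where
  "surv i h 0 = (if 1 \<le> i then 1 else 0)"
| "surv i 0 (Suc u) = (if 1 \<le> i then (surv (i + 1) 1 u + surv (i - 1) 1 u) / 2 else 0)"
| "surv i (Suc h) (Suc u) = (if 1 \<le> i then
      down (Suc h) (Suc u) * surv (i + 1) h (Suc u)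
      + (1 - down (Suc h) (Suc u)) * ((surv (i + 1) (h + 2) u + surv (i - 1) (h + 2) u) / 2)
     else 0)"

definition surv_up :: "int \<Rightarrow> nat \<Rightarrow> nat \<Rightarrow> real" where
  "surv_up i h u = (surv (i + 1) (Suc h) u + surv (i - 1) (Suc h) u) / 2"

text \<open>At height 1 the truncated \<open>h - 1\<close> is harmless because it is multiplied by \<open>down 0 _ = 0\<close>.\<close>
lemma surv_Suc:
  assumes "1 \<le> i"
  shows "surv i h (Suc u) =
    down h (Suc u) * surv (i + 1) (h - 1) (Suc u) + (1 - down h (Suc u)) * surv_up i h u"
  using assms by (cases h) (simp_all add: surv_up_def)

declare surv.simps(2,3) [simp del]

lemma surv_induct [case_names zero step]:
  assumes "\<And>i h. P i h 0"
    and "\<And>i h u. (\<And>i h. P i h u) \<Longrightarrow> (\<And>i. 0 < h \<Longrightarrow> P i (h - 1) (Suc u)) \<Longrightarrow> P i h (Suc u)"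
  shows "P (i :: int) (h :: nat) u"
proof (induction u arbitrary: i h)
  case (Suc u)
  show ?case
  proof (induction h arbitrary: i)
    case 0
    show ?case by (rule assms(2)) (use Suc in auto)
  next
    case (Suc h)
    show ?case by (rule assms(2)) (use Suc \<open>\<And>i h. P i h u\<close> in auto)
  qed
qed (rule assms(1))

lemma surv_outside: "i \<le> 0 \<Longrightarrow> surv i h u = 0"
  by (cases "(i, h, u)" rule: surv.cases) (auto simp: surv.simps)

lemma surv_bounds: "0 \<le> surv i h u \<and> surv i h u \<le> 1"
proof (induction i h u rule: surv_induct)
  case (step i h u)
  show ?case
  proof (cases "1 \<le> i")
    case True
    have up: "0 \<le> surv_up i h u" "surv_up i h u \<le> 1"
      using step(1)[of "i + 1" "Suc h"] step(1)[of "i - 1" "Suc h"] by (auto simp: surv_up_def)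
    show ?thesis
    proof (cases "h = 0")
      case True
      then show ?thesis using up by (simp add: surv_Suc[OF \<open>1 \<le> i\<close>])
    next
      case False
      then have s: "0 \<le> surv (i + 1) (h - 1) (Suc u)" "surv (i + 1) (h - 1) (Suc u) \<le> 1"
        using step(2)[of "i + 1"] by auto
      show ?thesis unfolding surv_Suc[OF \<open>1 \<le> i\<close>]
        using s up down_nonneg[of h "Suc u"] down_le_1[of h u]
        by (intro conjI convex_bound_le add_nonneg_nonneg mult_nonneg_nonneg) auto
    qed
  qed (simp add: surv_outside)
qed auto

lemmas surv_nonneg = surv_bounds[THEN conjunct1]
lemmas surv_le_1 = surv_bounds[THEN conjunct2]

text \<open>Starting with a step down is better for survival than starting with a step up: the two
  remaining ballot paths can be coupled so that the second stays above the first until they meet,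
  and until then it has made more steps up, which are worse for the first coordinate than
  steps down. The induction replaces the coupling by a consequence, the fact \<open>lift\<close> below: moving the
  starting point to the lower right does not hurt. Indeed survival from the old point is a mixture
  of survival from the new one and of survival after a step up, which is at most the former by the
  claim for a smaller \<open>u\<close>. Moving in this way after the step up gives \<open>surv_up (i + 1) h u\<close>, the
  survival probability after a step down followed by a step up. The right-hand side leaves that
  second step random, and by induction on \<open>h\<close> another step down only increases it.\<close>
lemma surv_up_le_down: "surv_up i (Suc h) u \<le> surv (i + 1) h (Suc u)"
proof (induction u arbitrary: i h rule: less_induct)
  case (less u)
  have lift: "surv i (Suc h) u \<le> surv (i + 1) h u" for i h
  proof (cases u)
    case (Suc v)
    show ?thesis
    proof (cases "1 \<le> i")
      case True
      then have "surv i (Suc h) u = down (Suc h) u * surv (i + 1) h u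
          + (1 - down (Suc h) u) * surv_up i (Suc h) v"
        by (simp add: surv_Suc[OF True] Suc)
      also have "\<dots> \<le> surv (i + 1) h u"
        using less[of v i h] unfolding Suc
        by (intro convex_bound_le) (auto simp: down_nonneg down_le_1)
      finally show ?thesis .
    qed (simp add: surv_outside surv_nonneg)
  qed auto
  show ?case
  proof (cases "0 \<le> i")
    case True
    have "surv_up i (Suc h) u \<le> surv_up (i + 1) h u" for h
      using lift[of "i + 1" "Suc h"] lift[of "i - 1" "Suc h"] by (simp add: surv_up_def)
    also have "surv_up (i + 1) h u \<le> surv (i + 1) h (Suc u)"
      using True
    proof (induction h arbitrary: i)
      case 0
      then show ?case using surv_Suc[of "i + 1" 0 u] by simp
    next
      case (Suc h)
      let ?a = "down (Suc h) (Suc u)" and ?q = "surv_up (i + 1) (Suc h) u"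
      have "?q \<le> surv_up (i + 2) h u"
        using lift[of "i + 2" "Suc h"] lift[of "i" "Suc h"] by (simp add: surv_up_def add.commute)
      also have "\<dots> \<le> surv (i + 2) h (Suc u)"
        using Suc.IH[of "i + 1"] Suc.prems by (simp add: add.commute)
      finally have "?a * ?q + (1 - ?a) * ?q \<le> ?a * surv (i + 2) h (Suc u) + (1 - ?a) * ?q"
        by (intro add_mono mult_left_mono) (auto simp: down_nonneg down_le_1)
      then show ?case
        using Suc.prems surv_Suc[of "i + 1" "Suc h" u] by (simp add: algebra_simps)
    qed
    finally show ?thesis .
  qed (simp add: surv_outside surv_up_def surv_nonneg)
qed

text \<open>Raising \<open>u\<close> lowers the probability of the better first step by \<open>down_antimono\<close>, and lowers
  both of the conditional probabilities by induction.\<close>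
lemma surv_antimono: "surv i h (Suc u) \<le> surv i h u"
proof (induction i h u rule: surv_induct)
  case (zero i h)
  then show ?case by (cases "1 \<le> i") (auto simp: surv_outside surv_le_1)
next
  case (step i h u)
  show ?case
  proof (cases "1 \<le> i")
    case True
    \<comment> \<open>Compare the weights \<open>?a\<close> and \<open>?b\<close> by writing a convex combination as \<open>?q + weight * (?s - ?q)\<close>,
      where \<open>?s - ?q\<close> is nonnegative by \<open>surv_up_le_down\<close>.\<close>
    let ?a = "down h (Suc u)" and ?b = "down h (Suc (Suc u))"
    let ?s = "surv (i + 1) (h - 1) (Suc u)" and ?q = "surv_up i h u"
    have "?b * surv (i + 1) (h - 1) (Suc (Suc u)) \<le> ?b * ?s"
      using step(2)[of "i + 1"] by (cases "h = 0") (auto intro!: mult_left_mono down_nonneg)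
    moreover have "surv_up i h (Suc u) \<le> ?q"
      using step(1)[of "i + 1" "Suc h"] step(1)[of "i - 1" "Suc h"] by (simp add: surv_up_def)
    then have "(1 - ?b) * surv_up i h (Suc u) \<le> (1 - ?b) * ?q"
      by (intro mult_left_mono) (auto simp: down_le_1)
    ultimately have "surv i h (Suc (Suc u)) \<le> ?q + ?b * (?s - ?q)"
      using surv_Suc[OF True, of h "Suc u"] by (simp add: algebra_simps)
    also have "?b * (?s - ?q) \<le> ?a * (?s - ?q)"
    proof (cases h)
      case (Suc g)
      show ?thesis
        using surv_up_le_down[of i g u] Suc by (intro mult_right_mono down_antimono) simp
    qed simp
    also have "?q + ?a * (?s - ?q) = surv i h (Suc u)"
      by (simp add: surv_Suc[OF True] algebra_simps)
    finally show ?thesis by simp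
  qed (simp add: surv_outside)
qed

text \<open>The subtracted term is superharmonic for the random lifted path and is at least 1 where the path
  has left the half plane. With the base \<open>3 / 4\<close>, a step down multiplies it by \<open>3 / 4\<close>, and a step up
  multiplies it on average by \<open>(3 / 4 + 4 / 3) / 2 = 25 / 24\<close>. At height 1, where the step up is
  forced, this loss is paid for by the extra factor there. At other heights the step down has
  probability at least 1/4, and \<open>1 / 4 * (3 / 4) * (25 / 24) + 3 / 4 * (25 / 24) < 1\<close> even if the
  step down ends at height 1. For \<open>i = 1\<close> the bound is still positive, because
  \<open>(3 / 4) * (25 / 24) < 1\<close>.\<close>
lemma surv_lower_bound:
  assumes "0 \<le> i"
  shows "1 - (3 / 4) ^ nat i * (if h = 0 then 25 / 24 else 1) \<le> surv i h u"
  using assms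
proof (induction i h u rule: surv_induct)
  case (zero i h)
  then show ?case by (cases "i = 0") auto
next
  case (step i h u)
  show ?case
  proof (cases "1 \<le> i")
    case True
    define l :: real where "l = (3 / 4) ^ nat (i - 1)"
    have l: "(3 / 4 :: real) ^ nat i = 3 / 4 * l" "(3 / 4 :: real) ^ nat (i + 1) = 9 / 16 * l"
    proof -
      have "nat i = Suc (nat (i - 1))" "nat (i + 1) = Suc (Suc (nat (i - 1)))"
        using True by auto
      then show "(3 / 4 :: real) ^ nat i = 3 / 4 * l" "(3 / 4 :: real) ^ nat (i + 1) = 9 / 16 * l"
        by (simp_all add: l_def)
    qed
    have "0 < l" by (simp add: l_def)
    have up: "1 - 25 / 32 * l \<le> surv_up i h u"
      using step(1)[of "i + 1" "Suc h"] step(1)[of "i - 1" "Suc h"] True l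
      by (simp add: surv_up_def flip: l_def)
    show ?thesis
    proof (cases h)
      case 0
      then show ?thesis using up l by (simp add: surv_Suc[OF True])
    next
      case (Suc g)
      let ?a = "down h (Suc u)"
      have "1 - 25 / 24 * (9 / 16 * l) \<le> surv (i + 1) g (Suc u)"
        using step(2)[of "i + 1"] l True Suc \<open>0 < l\<close> by (auto split: if_splits)
      then have "?a * (1 - 25 / 24 * (9 / 16 * l)) + (1 - ?a) * (1 - 25 / 32 * l)
          \<le> ?a * surv (i + 1) g (Suc u) + (1 - ?a) * surv_up i h u"
        using up by (intro add_mono mult_left_mono) (auto simp: down_nonneg down_le_1)
      also have "\<dots> = surv i h (Suc u)" using Suc by (simp add: surv_Suc[OF True])
      finally have "1 - 25 / 32 * l + 25 / 128 * (?a * l) \<le> surv i h (Suc u)"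
        by (simp add: field_simps)
      moreover have "1 / 4 * l \<le> ?a * l"
        using down_ge_quarter[of g u] \<open>0 < l\<close> Suc by (intro mult_right_mono) auto
      ultimately have "1 - 3 / 4 * l \<le> surv i h (Suc u)" using \<open>0 < l\<close> by linarith
      then show ?thesis by (simp add: l(1) Suc)
    qed
  qed (use step(3) in \<open>auto simp: surv_outside\<close>)
qed

lemma surv_limit:
  assumes "1 \<le> i"
  shows "\<exists>P>0. (\<lambda>u. surv i h u) \<longlonglongrightarrow> P"
proof -
  have dec: "decseq (\<lambda>u. surv i h u)"
    by (intro decseq_SucI surv_antimono)
  then obtain P where P: "(\<lambda>u. surv i h u) \<longlonglongrightarrow> P"
    by (rule decseq_convergent[where B = 0]) (use surv_nonneg in auto)
  have "(3 / 4 :: real) ^ nat i \<le> (3 / 4) ^ 1"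
    using assms by (intro power_decreasing) auto
  then have "7 / 32 \<le> surv i h u" for u
    using surv_lower_bound[of i h u] assms by (auto split: if_splits)
  then have "7 / 32 \<le> P"
    by (intro LIMSEQ_le_const[OF P]) auto
  then show ?thesis using P by (intro exI[of _ P]) auto
qed

section \<open>Ballot numbers\<close>

text \<open>The ballot theorem's count of the positive paths from height \<open>h + 1\<close> to height 1 with \<open>u\<close>
  steps up.\<close>
definition ballot :: "nat \<Rightarrow> nat \<Rightarrow> real" where
  "ballot h u = real (h + 1) / real (u + h + 1) * real ((2 * u + h) choose u)"

lemma ballot_down:
  "down (Suc h) (Suc u) * ballot (Suc h) (Suc u) = ballot h (Suc u)"
proof -
  have "(u + h + 2) * ((2 * u + h + 3) choose Suc u) = (2 * u + h + 3) * ((2 * u + h + 2) choose Suc u)"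
    using binomial_absorb_comp[of "2 * u + h + 3" "Suc u"] by (simp add: algebra_simps numeral_eq_Suc)
  then have "real (u + h + 2) * real ((2 * u + h + 3) choose Suc u)
      = real (2 * u + h + 3) * real ((2 * u + h + 2) choose Suc u)"
    by (metis of_nat_mult)
  then have *: "real ((2 * u + h + 3) choose Suc u)
      = real (2 * u + h + 3) * real ((2 * u + h + 2) choose Suc u) / real (u + h + 2)"
    by (simp add: field_simps)
  have e: "2 * Suc u + Suc h = 2 * u + h + 3" "2 * Suc u + h = 2 * u + h + 2" by simp_all
  show ?thesis unfolding ballot_def down_def e * by (simp add: divide_simps)
qed

lemma ballot_up:
  "(1 - down h (Suc u)) * ballot h (Suc u) = ballot (Suc h) u"
proof -
  have "(u + 1) * ((2 * u + h + 2) choose Suc u) = (2 * u + h + 2) * ((2 * u + h + 1) choose u)"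
    using binomial_absorption[of u "2 * u + h + 2"] by (simp add: algebra_simps)
  then have "real (u + 1) * real ((2 * u + h + 2) choose Suc u)
      = real (2 * u + h + 2) * real ((2 * u + h + 1) choose u)"
    by (metis of_nat_mult)
  then have *: "real ((2 * u + h + 2) choose Suc u)
      = real (2 * u + h + 2) * real ((2 * u + h + 1) choose u) / real (u + 1)"
    by (simp add: field_simps)
  have e: "2 * Suc u + h = 2 * u + h + 2" "2 * u + Suc h = 2 * u + h + 1" by simp_all
  show ?thesis unfolding ballot_def one_minus_down e * by (simp add: divide_simps)
qed

text \<open>Both sides satisfy the recursion over the first step: by \<open>ballot_down\<close> and \<open>ballot_up\<close>, the
  weights in \<^term>\<open>surv\<close> turn \<open>ballot h u\<close> into the ballot number after that step, and the factor
  2 lost by a step up is absorbed by the average over its two lifts.\<close>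
lemma M_eq: "real (M (2 * u + h) (i, int h + 1)) = 2 ^ u * ballot h u * surv i h u"
proof (induction i h u rule: surv_induct)
  case (zero i h)
  show ?case
  proof (induction h arbitrary: i)
    case 0
    show ?case by (simp add: M_0 axis_def ballot_def)
  next
    case (Suc h)
    show ?case
    proof (cases "1 \<le> i")
      case True
      then show ?thesis using Suc[of "i + 1"]
        by (simp add: M_Suc quadrant_def M_too_high ballot_def add.commute)
    qed (simp add: M_outside quadrant_def)
  qed
next
  case (step i h u)
  show ?case
  proof (cases "1 \<le> i")
    case True
    have e: "2 * Suc u + h = Suc (2 * u + Suc h)" by simp
    have q: "(i, int h + 1) \<in> quadrant" using True by (simp add: quadrant_def)
    have up: "real (M (2 * u + Suc h) (i + 1, int h + 2)) + real (M (2 * u + Suc h) (i - 1, int h + 2))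
       = 2 ^ Suc u * ballot (Suc h) u * surv_up i h u"
      using step(1)[of "Suc h" "i + 1"] step(1)[of "Suc h" "i - 1"]
      by (simp add: surv_up_def field_simps)
    have "real (M (2 * u + Suc h) (i + 1, int h))
       = 2 ^ Suc u * (down h (Suc u) * ballot h (Suc u)) * surv (i + 1) (h - 1) (Suc u)"
    proof (cases h)
      case 0
      then show ?thesis by (simp add: M_outside quadrant_def)
    next
      case (Suc g)
      then show ?thesis using step(2)[of "i + 1"] by (simp add: ballot_down add.commute)
    qed
    then show ?thesis unfolding e M_Suc[OF q] using up
      by (simp add: surv_Suc[OF True] ballot_up[symmetric] algebra_simps)
  qed (simp add: M_outside quadrant_def surv_outside)
qed

section \<open>Asymptotics\<close>

lemma central_binomial_gbinomial:
  "real ((2 * n) choose n) / 4 ^ n = (- 1) ^ n * ((- 1 / 2) gchoose n)"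
proof (induction n)
  case (Suc n)
  let ?c = "\<lambda>n. real ((2 * n) choose n)" and ?g = "\<lambda>n. (- 1 / 2 :: real) gchoose n"
  have "ballot 0 (Suc n) = ballot 1 n" using ballot_up[of 0 n] by simp
  then have 1: "?c (Suc n) = 2 * real ((2 * n + 1) choose n)"
    by (simp add: ballot_def divide_simps)
  have "(n + 1) * ((2 * n + 1) choose n) = (2 * n + 1) * ((2 * n) choose n)"
    using binomial_absorb_comp[of "2 * n + 1" n] by simp
  then have 2: "real (n + 1) * real ((2 * n + 1) choose n) = real (2 * n + 1) * ?c n"
    by (metis of_nat_mult)
  have 3: "real (n + 1) * ?c (Suc n) = 2 * (real (2 * n + 1) * ?c n)"
    unfolding 1 2[symmetric] by simp
  have 4: "real (n + 1) * ?g (Suc n) = - (real (2 * n + 1) / 2) * ?g n"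
    using gbinomial_mult_1[of "- 1 / 2 :: real" n] by (simp add: field_simps)
  have "real (n + 1) * (?c (Suc n) / 4 ^ Suc n) = real (2 * n + 1) / 2 * (?c n / 4 ^ n)"
    using 3 by (simp add: divide_simps)
  also have "\<dots> = (- 1) ^ Suc n * (- (real (2 * n + 1) / 2) * ?g n)"
    unfolding Suc by simp
  also have "\<dots> = real (n + 1) * ((- 1) ^ Suc n * ?g (Suc n))"
    unfolding 4[symmetric] by (simp only: mult.left_commute)
  finally show ?case by (subst (asm) mult_left_cancel) auto
qed simp

text \<open>In the form of the preceding lemma this is Euler's limit formula for the Gamma function.\<close>
lemma central_binomial_limit:
  "(\<lambda>n. sqrt (real n) * real ((2 * n) choose n) / 4 ^ n) \<longlonglongrightarrow> 1 / Gamma (1 / 2)"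
proof (rule Lim_transform_eventually)
  show "(\<lambda>n. ((- 1 / 2 :: real) gchoose n) / ((-1) ^ n / exp ((- 1 / 2 + 1) * of_real (ln (real n)))))
      \<longlonglongrightarrow> 1 / Gamma (1 / 2)"
    using gbinomial_asymptotic[of "- 1 / 2 :: real"] by (simp add: inverse_eq_divide)
  show "\<forall>\<^sub>F n in sequentially. ((- 1 / 2 :: real) gchoose n) / ((-1) ^ n / exp ((- 1 / 2 + 1) * of_real (ln (real n))))
     = sqrt (real n) * real ((2 * n) choose n) / 4 ^ n"
    using eventually_gt_at_top[of 0]
  proof eventually_elim
    case (elim n)
    have "exp (ln (real n) / 2) = sqrt (real n)"
      using elim by (simp add: powr_def flip: powr_half_sqrt)
    then show ?case
      using central_binomial_gbinomial[of n]
      by (simp add: field_simps)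
  qed
qed

text \<open>Catalan numbers are the case \<open>h = 0\<close>. Increasing \<open>h\<close> divides the ballot number by a \<^term>\<open>down\<close>
  probability, which has a positive limit.\<close>
lemma ballot_limit: "\<exists>K>0. (\<lambda>u. ballot h u * real u powr (3 / 2) / 4 ^ u) \<longlonglongrightarrow> K"
proof (induction h)
  case 0
  have "(\<lambda>u. real u / real (u + 1)) \<longlonglongrightarrow> 1"
    using LIMSEQ_n_over_Suc_n by simp
  from tendsto_mult[OF this central_binomial_limit, unfolded mult_1_left]
  have "(\<lambda>u. ballot 0 u * real u powr (3 / 2) / 4 ^ u) \<longlonglongrightarrow> 1 / Gamma (1 / 2)"
  proof (rule Lim_transform_eventually)
    show "\<forall>\<^sub>F u in sequentially. real u / real (u + 1) * (sqrt (real u) * real ((2 * u) choose u) / 4 ^ u) 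
      = ballot 0 u * real u powr (3 / 2) / 4 ^ u"
      using eventually_gt_at_top[of 0]
    proof eventually_elim
      case (elim u)
      have "real u powr (3 / 2) = real u powr 1 * real u powr (1 / 2)"
        unfolding powr_add[symmetric] by simp
      then show ?case using elim by (simp add: ballot_def powr_half_sqrt)
    qed
  qed
  moreover have "(1 :: real) / Gamma (1 / 2) > 0" by (simp add: Gamma_real_pos)
  ultimately show ?case by blast
next
  case (Suc h)
  then obtain K where K: "K > 0" "(\<lambda>u. ballot h u * real u powr (3 / 2) / 4 ^ u) \<longlonglongrightarrow> K"
    by blast
  define a where "a = real (h + 1) / (2 * real (h + 2))"
  have "(\<lambda>u. down (Suc h) u) \<longlonglongrightarrow> a"
    unfolding a_def down_def by real_asymp (simp add: field_simps)
  then have "(\<lambda>u. ballot h u * real u powr (3 / 2) / 4 ^ u / down (Suc h) u) \<longlonglongrightarrow> K / a"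
    by (intro tendsto_divide K) (auto simp: a_def)
  then have "(\<lambda>u. ballot (Suc h) u * real u powr (3 / 2) / 4 ^ u) \<longlonglongrightarrow> K / a"
  proof (rule Lim_transform_eventually)
    show "\<forall>\<^sub>F u in sequentially. ballot h u * real u powr (3 / 2) / 4 ^ u / down (Suc h) u
       = ballot (Suc h) u * real u powr (3 / 2) / 4 ^ u"
      using eventually_gt_at_top[of 0]
    proof eventually_elim
      case (elim u)
      then obtain v where v: "u = Suc v" by (cases u) auto
      have "down (Suc h) (Suc v) \<noteq> 0" using down_ge_quarter[of h v] by linarith
      then show ?case unfolding v ballot_down[of h v, symmetric] by simp
    qed
  qed
  moreover have "K / a > 0" using K by (simp add: a_def)
  ultimately show ?case by blast
qed

lemma M_limit:
  assumes "1 \<le> i"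
  shows "\<exists>C>0. (\<lambda>u. real (M (2 * u + h) (i, int h + 1)) /
    (2 powr (3 * real (2 * u + h) / 2) / real (2 * u + h) powr (3 / 2))) \<longlonglongrightarrow> C"
proof -
  obtain P where P: "P > 0" "(\<lambda>u. surv i h u) \<longlonglongrightarrow> P" using surv_limit[OF assms] by blast
  obtain K where K: "K > 0" "(\<lambda>u. ballot h u * real u powr (3 / 2) / 4 ^ u) \<longlonglongrightarrow> K"
    using ballot_limit by blast
  define c where "c = 2 powr (- (3 * real h / 2))"
  have r: "(\<lambda>u. (real (2 * u + h) / real u) powr (3 / 2)) \<longlonglongrightarrow> 2 powr (3 / 2)"
  proof (rule tendsto_powr)
    show "(\<lambda>u. real (2 * u + h) / real u) \<longlonglongrightarrow> 2" by real_asymp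
  qed auto
  have "(\<lambda>u. c * (real (2 * u + h) / real u) powr (3 / 2)
      * (ballot h u * real u powr (3 / 2) / 4 ^ u) * surv i h u) \<longlonglongrightarrow> c * 2 powr (3 / 2) * K * P"
    by (intro tendsto_intros r K P)
  then have "(\<lambda>u. real (M (2 * u + h) (i, int h + 1)) /
    (2 powr (3 * real (2 * u + h) / 2) / real (2 * u + h) powr (3 / 2))) \<longlonglongrightarrow> c * 2 powr (3 / 2) * K * P"
  proof (rule Lim_transform_eventually)
    show "\<forall>\<^sub>F u in sequentially. c * (real (2 * u + h) / real u) powr (3 / 2)
      * (ballot h u * real u powr (3 / 2) / 4 ^ u) * surv i h u
      = real (M (2 * u + h) (i, int h + 1)) /
    (2 powr (3 * real (2 * u + h) / 2) / real (2 * u + h) powr (3 / 2))"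
      using eventually_gt_at_top[of 0]
    proof eventually_elim
      case (elim u)
      have "(2 :: real) powr real (3 * u) = (2 ^ 3) ^ u"
        by (simp only: powr_realpow power_mult zero_less_numeral)
      also have "\<dots> = (2 * 4) ^ u" by simp
      also have "\<dots> = 2 ^ u * 4 ^ u" by (rule power_mult_distrib)
      finally have e: "(2 :: real) powr real (3 * u) = 2 ^ u * 4 ^ u" .
      have "2 powr (3 * real (2 * u + h) / 2) = 2 powr real (3 * u) * 2 powr (3 * real h / 2)"
        unfolding powr_add[symmetric] by (simp add: field_simps)
      also have "\<dots> = 2 ^ u * 4 ^ u / c"
        unfolding e c_def powr_minus by (simp only: divide_inverse inverse_inverse_eq)
      finally have p: "2 powr (3 * real (2 * u + h) / 2) = 2 ^ u * 4 ^ u / c" .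
      have "(real (2 * u + h) / real u) powr (3 / 2) * real u powr (3 / 2) = real (2 * u + h) powr (3 / 2)"
        using elim by (simp add: powr_divide)
      moreover have "c > 0" by (simp add: c_def)
      ultimately show ?case unfolding M_eq p
        by (simp add: field_simps)
    qed
  qed
  moreover have "c * 2 powr (3 / 2) * K * P > 0" using K P by (simp add: c_def)
  ultimately show ?thesis by blast
qed

theorem mainTheorem5:
  fixes x :: "int \<times> int"
  assumes "x \<in> quadrant"
  shows "\<exists>C::real. C > 0 \<and>
    asymp_equiv (\<lambda>n. real (M n x)) (inf at_top (principal (admissible x)))
      (\<lambda>n. C * (2 powr (3 * real n / 2) / real n powr (3 / 2))) \<and>
    (\<forall>n. n \<notin> admissible x \<longrightarrow> M n x = 0)"
proof -
  define h where "h = nat (snd x - 1)"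
  have x: "x = (fst x, int h + 1)" and i: "1 \<le> fst x"
    using assms by (auto simp: h_def quadrant_def)
  let ?F = "inf at_top (principal (admissible x))"
  let ?g = "\<lambda>n. 2 powr (3 * real n / 2) / real n powr (3 / 2)"
  obtain C where C: "C > 0" "(\<lambda>u. real (M (2 * u + h) x) / ?g (2 * u + h)) \<longlonglongrightarrow> C"
    using M_limit[OF i, of h] x by auto
  have "filterlim (\<lambda>n. (n - h) div 2) sequentially ?F"
  proof (rule filterlim_mono[OF _ order_refl inf_le1])
    show "filterlim (\<lambda>n. (n - h) div 2) sequentially sequentially"
      unfolding filterlim_at_top
    proof
      fix Z
      show "\<forall>\<^sub>F n in sequentially. Z \<le> (n - h) div 2"
        using eventually_ge_at_top[of "2 * Z + h"] by eventually_elim auto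
    qed
  qed
  from filterlim_compose[OF C(2) this]
  have "((\<lambda>n. real (M n x) / ?g n) \<longlongrightarrow> C) ?F"
  proof (rule Lim_transform_eventually)
    have "\<forall>\<^sub>F n in ?F. n \<ge> h" by (rule filter_leD[OF inf_le1 eventually_ge_at_top])
    moreover have "\<forall>\<^sub>F n in ?F. n \<in> admissible x"
      by (rule filter_leD[OF inf_le2]) (simp add: eventually_principal)
    ultimately show "\<forall>\<^sub>F n in ?F. real (M (2 * ((n - h) div 2) + h) x) / ?g (2 * ((n - h) div 2) + h)
        = real (M n x) / ?g n"
    proof eventually_elim
      case (elim n)
      have "odd (int n + (int h + 1))"
        using elim(2) by (subst (asm) x) (simp add: admissible_def)
      then have "even (n - h)" using elim(1) by simp
      then show ?case using elim(1) by simp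
    qed
  qed
  then show ?thesis
    using C(1) M_parity by (intro exI[of _ C] conjI asymp_equivI'_const) auto
qed

end
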